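(* Two weight constraint programs in which $\neg$ does not occur are strongly equivalent if and only if they have the same positive SE-models.
   Context: Fix a set of propositional atoms; a literal is an atom $A$ or $\neg A$, and a set of literals is consistent if it does not contain both $A$ and $\neg A$. A rule element is a literal (positive rule element) or a literal preceded by $\mathit{not}$ (negative rule element). A weight assignment is $e=w$ with $e$ a rule element and $w$ a nonnegative real. A weight constraint is $L\le S\le U$ where $S$ is a finite set of weight assignments and $L,U$ are reals or $-\infty,+\infty$. A WCP rule is $C_0\leftarrow C_1,\dots,C_n$ ($n\ge0$) with weight constraints $C_i$ where $C_0$ contains no negative rule elements; the rule elements in $C_0$ are its head literals. A weight constraint program is a set of WCP rules. For a consistent set $X$ of literals, $X\models \ell$ iff $\ell\in X$ and $X\models\mathit{not}\,\ell$ iff $\ell\notin X$; $v(S,X)=\sum\{w : (e=w)\in S,\ X\models e\}$; $X$ satisfies $L\le S\le U$ iff $L\le v(S,X)\le U$; $X$ satisfies a rule if it satisfies $C_0$ whenever it satisfies all of $C_1,\dots,C_n$; $X$ satisfies a program if it satisfies every rule. The reduct of $L\le S$ w.r.t. $X$ is $L^X\le S'$ where $S'$ is the set of $e=w\in S$ with $e$ positive and $L^X=L-v(S\setminus S',X)$. The reduct w.r.t. $X$ of a rule $L_0\le S_0\le U_0\leftarrow L_1\le S_1\le U_1,\dots,L_n\le S_n\le U_n$ is the set of rules $e\leftarrow (L_1\le S_1)^X,\dots,(L_n\le S_n)^X$ for every head literal $e$ with $X\models e$, provided $v(S_i,X)\le U_i$ for all $i$ (otherwise it is empty); a literal $e$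 as head stands for $1\le\{e=1\}$. $P^X$ is the union of the reducts of the rules of $P$. $X$ is an answer set of $P$ if $X$ satisfies $P$ and no proper subset of $X$ satisfies $P^X$. Programs are equivalent if they have the same answer sets; $P,Q$ are strongly equivalent if $P\cup R$ and $Q\cup R$ are equivalent for every weight constraint program $R$. For consistent sets of literals $X\subseteq Y$, $(X,Y)$ is an SE-model of $P$ if $Y$ satisfies $P$ and $X$ satisfies $P^Y$; it is a positive SE-model if $X$ and $Y$ consist only of atoms. *)

theory Defs
  imports "HOL-Library.Extended_Real"
begin

text \<open>The propositional atoms are the elements of the type \<open>'a\<close>.\<close>

datatype 'a literal = Atom 'a | Neg 'a

definition consistent :: "'a literal set \<Rightarrow> bool" where
  "consistent X \<longleftrightarrow> \<not> (\<exists>A. Atom A \<in> X \<and> Neg A \<in> X)"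

text \<open>\<open>NotLit\<close> is negation as failure, in contrast to the classical negation \<open>Neg\<close>.\<close>

datatype 'a rule_elem = Lit (lit_of: "'a literal") | NotLit (lit_of: "'a literal")

text \<open>\<open>WC L S U\<close> stands for \<open>L \<le> S \<le> U\<close>, and the pair \<open>(e, w)\<close> for the weight assignment
  \<open>e = w\<close>. The same rule element may occur in \<open>S\<close> with several different weights.
  Finiteness of \<open>S\<close> and nonnegativity of the weights are imposed by \<open>wf_constraint\<close>.\<close>

datatype 'a wconstraint =
  WC (lower: ereal) (assigns: "('a rule_elem \<times> real) set") (upper: ereal)

datatype 'a wrule = WRule (head: "'a wconstraint") (body: "'a wconstraint list")

type_synonym 'a wprogram = "'a wrule set"

definition wf_constraint :: "'a wconstraint \<Rightarrow> bool" where
  "wf_constraint C \<longleftrightarrow> finite (assigns C) \<and> (\<forall>(e, w) \<in> assigns C. w \<ge> 0)"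

definition wf_rule :: "'a wrule \<Rightarrow> bool" where
  "wf_rule r \<longleftrightarrow> wf_constraint (head r) \<and> (\<forall>C \<in> set (body r). wf_constraint C)
     \<and> (\<forall>(e, w) \<in> assigns (head r). is_Lit e)"

definition weight_constraint_program :: "'a wprogram \<Rightarrow> bool" where
  "weight_constraint_program P \<longleftrightarrow> (\<forall>r \<in> P. wf_rule r)"

definition head_literals :: "'a wrule \<Rightarrow> 'a literal set" where
  "head_literals r = {l. \<exists>w. (Lit l, w) \<in> assigns (head r)}"

primrec sat_elem :: "'a literal set \<Rightarrow> 'a rule_elem \<Rightarrow> bool" where
  "sat_elem X (Lit l) \<longleftrightarrow> l \<in> X"
| "sat_elem X (NotLit l) \<longleftrightarrow> l \<notin> X"

definition val :: "('a rule_elem \<times> real) set \<Rightarrow> 'a literal set \<Rightarrow> real" where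
  "val S X = (\<Sum>(e, w) \<in> {(e, w) \<in> S. sat_elem X e}. w)"

definition sat_constraint :: "'a literal set \<Rightarrow> 'a wconstraint \<Rightarrow> bool" where
  "sat_constraint X C \<longleftrightarrow>
     lower C \<le> ereal (val (assigns C) X) \<and> ereal (val (assigns C) X) \<le> upper C"

definition sat_rule :: "'a literal set \<Rightarrow> 'a wrule \<Rightarrow> bool" where
  "sat_rule X r \<longleftrightarrow>
     ((\<forall>C \<in> set (body r). sat_constraint X C) \<longrightarrow> sat_constraint X (head r))"

definition sat_program :: "'a literal set \<Rightarrow> 'a wprogram \<Rightarrow> bool" where
  "sat_program X P \<longleftrightarrow> (\<forall>r \<in> P. sat_rule X r)"

definition positive_part :: "('a rule_elem \<times> real) set \<Rightarrow> ('a rule_elem \<times> real) set" where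
  "positive_part S = {(e, w) \<in> S. is_Lit e}"

text \<open>A constraint \<open>L \<le> S\<close> without upper bound is \<open>WC L S \<infinity>\<close>. The reduct of a constraint
  ignores its upper bound, which is accounted for in \<open>reduct_rule\<close>.\<close>

definition reduct_constraint :: "'a literal set \<Rightarrow> 'a wconstraint \<Rightarrow> 'a wconstraint" where
  "reduct_constraint X C =
     WC (lower C - ereal (val (assigns C - positive_part (assigns C)) X))
        (positive_part (assigns C)) \<infinity>"

definition literal_constraint :: "'a literal \<Rightarrow> 'a wconstraint" where
  "literal_constraint l = WC 1 {(Lit l, 1)} \<infinity>"

definition reduct_rule :: "'a literal set \<Rightarrow> 'a wrule \<Rightarrow> 'a wprogram" where
  "reduct_rule X r =
     (if \<forall>C \<in> set (body r). ereal (val (assigns C) X) \<le> upper C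
      then {WRule (literal_constraint l) (map (reduct_constraint X) (body r)) |l.
              l \<in> head_literals r \<and> l \<in> X}
      else {})"

definition reduct :: "'a literal set \<Rightarrow> 'a wprogram \<Rightarrow> 'a wprogram" where
  "reduct X P = (\<Union>r \<in> P. reduct_rule X r)"

definition answer_set :: "'a wprogram \<Rightarrow> 'a literal set \<Rightarrow> bool" where
  "answer_set P X \<longleftrightarrow>
     consistent X \<and> sat_program X P \<and> (\<forall>Z. Z \<subset> X \<longrightarrow> \<not> sat_program Z (reduct X P))"

definition equivalent :: "'a wprogram \<Rightarrow> 'a wprogram \<Rightarrow> bool" where
  "equivalent P Q \<longleftrightarrow> {X. answer_set P X} = {X. answer_set Q X}"

definition strongly_equivalent :: "'a wprogram \<Rightarrow> 'a wprogram \<Rightarrow> bool" where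
  "strongly_equivalent P Q \<longleftrightarrow>
     (\<forall>R. weight_constraint_program R \<longrightarrow> equivalent (P \<union> R) (Q \<union> R))"

definition se_models :: "'a wprogram \<Rightarrow> ('a literal set \<times> 'a literal set) set" where
  "se_models P = {(X, Y). consistent X \<and> consistent Y \<and> X \<subseteq> Y
     \<and> sat_program Y P \<and> sat_program X (reduct Y P)}"

definition positive_se_models :: "'a wprogram \<Rightarrow> ('a literal set \<times> 'a literal set) set" where
  "positive_se_models P = {(X, Y) \<in> se_models P. X \<subseteq> range Atom \<and> Y \<subseteq> range Atom}"

definition neg_free_constraint :: "'a wconstraint \<Rightarrow> bool" where
  "neg_free_constraint C \<longleftrightarrow> (\<forall>(e, w) \<in> assigns C. lit_of e \<in> range Atom)"

definition neg_free :: "'a wprogram \<Rightarrow> bool" where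
  "neg_free P \<longleftrightarrow>
     (\<forall>r \<in> P. neg_free_constraint (head r) \<and> (\<forall>C \<in> set (body r). neg_free_constraint C))"

end

(* For consistent X and Y with X \<subseteq> Y, whether (X, Y) is an SE-model of P can be read off from whether Y is
  an answer set of P extended by the facts Y, and by the facts X together with b \<leftarrow> c for all
  b, c \<in> Y - X: the only proper subset of Y that satisfies the reduct of the latter rules is X.
  Hence strong equivalence amounts to equality of all SE-models. If \<not> does not occur in P, negative
  literals in X and Y are irrelevant, so the positive SE-models determine all the others. *)

theory Submission imports Defs begin

lemma sat_program_Un [simp]: "sat_program X (P \<union> Q) \<longleftrightarrow> sat_program X P \<and> sat_program X Q"
  by (auto simp: sat_program_def)

lemma reduct_Un [simp]: "reduct X (P \<union> Q) = reduct X P \<union> reduct X Q"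
  by (auto simp: reduct_def)

lemma consistent_subset: "consistent Y \<Longrightarrow> X \<subseteq> Y \<Longrightarrow> consistent X"
  by (auto simp: consistent_def)

lemma sat_literal_constraint [simp]: "sat_constraint X (literal_constraint l) \<longleftrightarrow> l \<in> X"
proof -
  have "{(e, w). (e, w) \<in> {(Lit l, 1::real)} \<and> sat_elem X e} = (if l \<in> X then {(Lit l, 1)} else {})"
    by auto
  then show ?thesis
    by (auto simp: sat_constraint_def literal_constraint_def val_def one_ereal_def)
qed

lemma reduct_literal_constraint [simp]:
  "reduct_constraint X (literal_constraint l) = literal_constraint l"
proof -
  have "positive_part {(Lit l, 1)} = {(Lit l, 1)}"
    by (auto simp: positive_part_def)
  then show ?thesis
    by (simp add: reduct_constraint_def literal_constraint_def val_def one_ereal_def)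
qed

lemma upper_literal_constraint [simp]: "upper (literal_constraint l) = \<infinity>"
  by (simp add: literal_constraint_def)

text \<open>Every head in the reduct is a literal of \<open>Y\<close>. Hence \<open>(Y, Y)\<close>
  is an SE-model as soon as \<open>Y\<close> is consistent and satisfies \<open>P\<close>.\<close>

lemma sat_reduct_self: "sat_program Y (reduct Y P)"
  by (auto simp: sat_program_def sat_rule_def reduct_def reduct_rule_def)

definition literal_rule :: "'a literal \<Rightarrow> 'a literal list \<Rightarrow> 'a wrule" where
  "literal_rule b cs = WRule (literal_constraint b) (map literal_constraint cs)"

lemma wf_literal_rule: "wf_rule (literal_rule b cs)"
  by (auto simp: literal_rule_def wf_rule_def wf_constraint_def literal_constraint_def)

lemma sat_literal_rule [simp]: "sat_rule X (literal_rule b cs) \<longleftrightarrow> (set cs \<subseteq> X \<longrightarrow> b \<in> X)"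
  by (auto simp: literal_rule_def sat_rule_def)

lemma reduct_literal_rule [simp]:
  "reduct_rule Y (literal_rule b cs) = (if b \<in> Y then {literal_rule b cs} else {})"
proof -
  have "head_literals (literal_rule b cs) = {b}"
    by (auto simp: head_literals_def literal_rule_def literal_constraint_def)
  then show ?thesis
    by (auto simp: reduct_rule_def) (auto simp: literal_rule_def)
qed

text \<open>For \<open>X = Y\<close> only the facts remain, so one definition covers both
  extensions.\<close>

definition separating_program :: "'a literal set \<Rightarrow> 'a literal set \<Rightarrow> 'a wprogram" where
  "separating_program X Y =
     (\<lambda>b. literal_rule b []) ` X \<union> (\<lambda>(b, c). literal_rule b [c]) ` ((Y - X) \<times> (Y - X))"

lemma wf_separating_program: "weight_constraint_program (separating_program X Y)"
  by (auto simp: weight_constraint_program_def separating_program_def wf_literal_rule)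

lemma sat_separating_program:
  "sat_program Z (separating_program X Y) \<longleftrightarrow> X \<subseteq> Z \<and> (Y - X \<subseteq> Z \<or> (Y - X) \<inter> Z = {})"
  by (simp add: sat_program_def separating_program_def ball_Un) blast

text \<open>These rules have no \<open>NotLit\<close> and no finite upper bounds, and all their
  heads lie in \<open>Y\<close>, so the reduct changes nothing.\<close>

lemma reduct_separating_program:
  "X \<subseteq> Y \<Longrightarrow> reduct Y (separating_program X Y) = separating_program X Y"
  by (auto simp: reduct_def separating_program_def)

lemma answer_set_separating_program:
  assumes "consistent Y" "X \<subseteq> Y"
  shows "answer_set (P \<union> separating_program X Y) Y \<longleftrightarrow>
    sat_program Y P \<and> (X \<subset> Y \<longrightarrow> \<not> sat_program X (reduct Y P))"
proof -
  \<comment> \<open>A proper subset of \<open>Y\<close> that includes \<open>X\<close> cannot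
    include \<open>Y - X\<close>, so it must be disjoint from \<open>Y - X\<close>.\<close>
  have "sat_program Z (separating_program X Y) \<longleftrightarrow> Z = X" if "Z \<subset> Y" for Z
    using that by (auto simp: sat_separating_program)
  moreover have "sat_program Y (separating_program X Y)"
    using assms by (auto simp: sat_separating_program)
  ultimately show ?thesis
    using assms by (auto simp: answer_set_def reduct_separating_program)
qed

lemma se_models_iff:
  "(X, Y) \<in> se_models P \<longleftrightarrow> consistent Y \<and> X \<subseteq> Y \<and> sat_program Y P \<and> sat_program X (reduct Y P)"
  by (auto simp: se_models_def intro: consistent_subset)

text \<open>The right-hand side mentions \<open>P\<close> only through answer sets of extensions,
  which strong equivalence preserves. The case \<open>X = Y\<close> is settled by
  \<open>sat_reduct_self\<close>.\<close>

lemma se_models_iff_answer_set: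
  "(X, Y) \<in> se_models P \<longleftrightarrow> consistent Y \<and> X \<subseteq> Y \<and> answer_set (P \<union> separating_program Y Y) Y
     \<and> (X \<noteq> Y \<longrightarrow> \<not> answer_set (P \<union> separating_program X Y) Y)"
  by (auto simp: se_models_iff answer_set_separating_program sat_reduct_self)

text \<open>Conversely, answer sets of an extension depend on \<open>P\<close> only through its
  SE-models: \<open>(Y, Y)\<close> records that \<open>Y\<close> is consistent and satisfies
  \<open>P\<close>, and the pairs \<open>(Z, Y)\<close> record which subsets satisfy the
  reduct.\<close>

lemma answer_set_Un_iff_se_models:
  "answer_set (P \<union> R) Y \<longleftrightarrow> sat_program Y R \<and> (Y, Y) \<in> se_models P
     \<and> (\<forall>Z. Z \<subset> Y \<longrightarrow> (Z, Y) \<in> se_models P \<longrightarrow> \<not> sat_program Z (reduct Y R))"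
  by (auto simp: answer_set_def se_models_iff sat_reduct_self)

lemma strongly_equivalent_iff_se_models:
  "strongly_equivalent P Q \<longleftrightarrow> se_models P = se_models Q"
proof
  assume "strongly_equivalent P Q"
  then have "answer_set (P \<union> separating_program X Y) Z \<longleftrightarrow>
      answer_set (Q \<union> separating_program X Y) Z" for X Y Z
    using wf_separating_program by (auto simp: strongly_equivalent_def equivalent_def set_eq_iff)
  then show "se_models P = se_models Q"
    by (simp add: set_eq_iff se_models_iff_answer_set)
next
  assume "se_models P = se_models Q"
  then show "strongly_equivalent P Q"
    by (simp add: strongly_equivalent_def equivalent_def answer_set_Un_iff_se_models)
qed

text \<open>Whether \<open>X\<close> satisfies \<open>Lit l\<close> or \<open>NotLit l\<close>
  depends only on membership of \<open>l\<close> in \<open>X\<close>, and dropping negative literals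
  from \<open>X\<close> does not affect this for an atom \<open>l\<close>.\<close>

lemma val_atoms:
  assumes "\<forall>(e, w) \<in> S. lit_of e \<in> range Atom"
  shows "val S (X \<inter> range Atom) = val S X"
proof -
  have "sat_elem (X \<inter> range Atom) e \<longleftrightarrow> sat_elem X e" if "(e, w) \<in> S" for e w
    using assms that by (cases e) auto
  then have "{(e, w) \<in> S. sat_elem (X \<inter> range Atom) e} = {(e, w) \<in> S. sat_elem X e}"
    by auto
  then show ?thesis
    by (simp add: val_def)
qed

lemma sat_constraint_atoms:
  "neg_free_constraint C \<Longrightarrow> sat_constraint (X \<inter> range Atom) C \<longleftrightarrow> sat_constraint X C"
  by (simp add: neg_free_constraint_def sat_constraint_def val_atoms)

lemma sat_program_atoms:
  "neg_free P \<Longrightarrow> sat_program (X \<inter> range Atom) P \<longleftrightarrow> sat_program X P"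
  by (simp add: neg_free_def sat_program_def sat_rule_def sat_constraint_atoms)

lemma neg_free_reduct_constraint:
  "neg_free_constraint C \<Longrightarrow> neg_free_constraint (reduct_constraint Y C)"
  by (auto simp: neg_free_constraint_def reduct_constraint_def positive_part_def)

lemma neg_free_reduct:
  assumes "neg_free P"
  shows "neg_free (reduct Y P)"
proof -
  have "l \<in> range Atom" if "r \<in> P" "l \<in> head_literals r" for r l
    using assms that by (fastforce simp: neg_free_def neg_free_constraint_def head_literals_def)
  then have "neg_free_constraint (literal_constraint l)" if "r \<in> P" "l \<in> head_literals r" for r l
    using that by (auto simp: neg_free_constraint_def literal_constraint_def)
  then show ?thesis
    using assms
    by (auto simp: neg_free_def reduct_def reduct_rule_def neg_free_reduct_constraint
        split: if_splits)
qed

lemma reduct_constraint_atoms: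
  assumes "neg_free_constraint C"
  shows "reduct_constraint (Y \<inter> range Atom) C = reduct_constraint Y C"
proof -
  have "\<forall>(e, w) \<in> assigns C - positive_part (assigns C). lit_of e \<in> range Atom"
    using assms by (auto simp: neg_free_constraint_def)
  then show ?thesis
    by (simp add: reduct_constraint_def val_atoms)
qed

text \<open>The reduct depends on \<open>Y\<close> only through the values of the body constraints
  and the head literals that lie in \<open>Y\<close>. Both involve atoms only.\<close>

lemma reduct_atoms:
  assumes "neg_free P"
  shows "reduct (Y \<inter> range Atom) P = reduct Y P"
proof -
  have "reduct_rule (Y \<inter> range Atom) r = reduct_rule Y r" if "r \<in> P" for r
  proof -
    have "neg_free_constraint C" if "C \<in> set (body r)" for C
      using assms that \<open>r \<in> P\<close> by (simp add: neg_free_def)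
    then have "val (assigns C) (Y \<inter> range Atom) = val (assigns C) Y"
      and "reduct_constraint (Y \<inter> range Atom) C = reduct_constraint Y C"
      if "C \<in> set (body r)" for C
      using that by (simp_all add: val_atoms reduct_constraint_atoms neg_free_constraint_def)
    moreover have "l \<in> head_literals r \<and> l \<in> Y \<inter> range Atom \<longleftrightarrow> l \<in> head_literals r \<and> l \<in> Y" for l
      using assms \<open>r \<in> P\<close>
      by (fastforce simp: neg_free_def neg_free_constraint_def head_literals_def)
    ultimately show ?thesis
      unfolding reduct_rule_def by (simp cong: map_cong)
  qed
  then show ?thesis
    by (simp add: reduct_def)
qed

text \<open>Intersecting with \<open>range Atom\<close> forgets the negative literals, so
  \<open>consistent Y\<close> and \<open>X \<subseteq> Y\<close> are stated separately. As they do
  not involve \<open>P\<close>, the positive SE-models determine all SE-models.\<close>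

lemma se_models_iff_positive:
  assumes "neg_free P"
  shows "(X, Y) \<in> se_models P \<longleftrightarrow>
    consistent Y \<and> X \<subseteq> Y \<and> (X \<inter> range Atom, Y \<inter> range Atom) \<in> positive_se_models P"
  using assms
  by (auto simp: positive_se_models_def se_models_iff sat_program_atoms reduct_atoms
      neg_free_reduct intro: consistent_subset)

theorem theorem6:
  fixes P Q :: "'a wprogram"
  assumes "weight_constraint_program P" and "weight_constraint_program Q"
    and "neg_free P" and "neg_free Q"
  shows "strongly_equivalent P Q \<longleftrightarrow> positive_se_models P = positive_se_models Q"
proof -
  have "se_models P = se_models Q \<longleftrightarrow> positive_se_models P = positive_se_models Q"
  proof
    assume "se_models P = se_models Q"
    then show "positive_se_models P = positive_se_models Q"
      by (simp add: positive_se_models_def)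
  next
    assume "positive_se_models P = positive_se_models Q"
    then show "se_models P = se_models Q"
      using assms by (simp add: set_eq_iff se_models_iff_positive)
  qed
  then show ?thesis
    by (simp add: strongly_equivalent_iff_se_models)
qed

end
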